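(* Let $A$ be a $2$-primitive set. Then \[ \sum_{n \in A} \frac{1}{n \log n} \;\le\; \sum_{p \in \mathcal{P}(A)} \frac{1}{p \log p}. \]
   Context: For an integer $k\ge 1$, a set $A$ of integers greater than $1$ with $|A|\ge k+1$ is called $k$-primitive if no element of $A$ divides the product of $k$ distinct other elements of $A$. $\mathcal{P}(A)$ denotes the set of primes dividing some member of $A$. Sums over $p$ run over primes; $\log$ is the natural logarithm. *)

theory Defs
  imports "HOL-Analysis.Analysis" "HOL-Computational_Algebra.Primes"
begin

(* card is 0 on infinite sets, so the size condition |A| >= k + 1 treats infinite A separately. *)
definition k_primitive :: "nat \<Rightarrow> nat set \<Rightarrow> bool" where
  "k_primitive k A \<longleftrightarrow>
     1 \<le> k \<and>
     (\<forall>n\<in>A. 1 < n) \<and>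
     (infinite A \<or> k + 1 \<le> card A) \<and>
     (\<forall>a\<in>A. \<forall>B. B \<subseteq> A - {a} \<and> finite B \<and> card B = k \<longrightarrow> \<not> a dvd \<Prod>B)"

definition primes_dividing :: "nat set \<Rightarrow> nat set" where
  "primes_dividing A = {p. prime p \<and> (\<exists>n\<in>A. p dvd n)}"

end

theory Submission
  imports Defs
begin

text \<open>
  Call a divisor \<open>d\<close> of \<open>a \<in> A\<close> private if it divides no other element of \<open>A\<close>. In a 2-primitive set,
  whenever \<open>a = u v\<close> with \<open>u\<close> and \<open>v\<close> coprime, one of \<open>u\<close> and \<open>v\<close> is private. Write
  \<open>f n = 1 / (n log n)\<close>. Elements with a private prime \<open>p\<close> inject into the private primes, and
  \<open>f a \<le> f p\<close>. Elements with a private prime power \<open>p^k\<close> but no private prime inject into the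
  non-private primes via \<open>a \<mapsto> p\<close>, and \<open>f a \<le> f (p\<^sup>2) = f p / (2 p)\<close>. Every other element \<open>a\<close> has
  a private divisor \<open>d\<close> with \<open>d\<^sup>3 \<le> a\<^sup>2\<close>; it is not a prime power, so \<open>d = p m\<close> with \<open>p\<close> an odd
  non-private prime and \<open>m \<ge> 2\<close>, whence \<open>f a \<le> f p / (3/2 \<cdot> p\<^bsup>1/2\<^esup> m\<^bsup>3/2\<^esup>)\<close>. As \<open>\<Sum>\<^bsub>m \<ge> 2\<^esub> m\<^bsup>-3/2\<^esup> \<le> 2\<close>,
  the last two classes together use at most \<open>f p\<close> for each non-private prime \<open>p\<close>.
\<close>

definition private_divisor :: "nat set \<Rightarrow> nat \<Rightarrow> nat \<Rightarrow> bool" where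
  "private_divisor A a d \<longleftrightarrow> d dvd a \<and> (\<forall>b\<in>A. d dvd b \<longrightarrow> b = a)"

definition erdos_weight :: "nat \<Rightarrow> real" where
  "erdos_weight n = 1 / (real n * ln (real n))"

section \<open>Estimates for the weight and two summation tools\<close>

lemma erdos_weight_nonneg: "erdos_weight n \<ge> 0"
  by (cases "n = 0") (auto simp: erdos_weight_def)

lemma erdos_weight_antimono:
  assumes "1 < m" "m \<le> n"
  shows "erdos_weight n \<le> erdos_weight m"
  unfolding erdos_weight_def using assms by (intro divide_left_mono mult_mono) auto

lemma erdos_weight_square:
  assumes "1 < p"
  shows "erdos_weight (p\<^sup>2) = erdos_weight p / (2 * real p)"
  using assms by (simp add: erdos_weight_def ln_mult power2_eq_square)

text \<open>Telescoping: the term at \<open>m\<close> is at most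
  \<open>2 / sqrt (m - 1) - 2 / sqrt m\<close>, and the upper ends cancel down to
  \<open>2 / sqrt 1\<close>.\<close>

lemma sum_inverse_three_halves_le:
  "(\<Sum>m=2..n. 1 / (real m * sqrt (real m))) \<le> 2"
proof -
  have step: "1 / ((x + 1) * sqrt (x + 1)) \<le> 2 / sqrt x - 2 / sqrt (x + 1)" if "x > 0" for x :: real
  proof -
    define s where "s = sqrt x"
    define t where "t = sqrt (x + 1)"
    have st: "0 < s" "s \<le> t" "0 < t" using that by (auto simp: s_def t_def)
    have sq: "t * t = x + 1" "s * s = x" using that by (auto simp: s_def t_def)
    have "s * (t + s) \<le> t * (t + t)" using st by (intro mult_mono) auto
    moreover have "(t - s) * (t + s) = 1" using sq by (simp add: algebra_simps)
    ultimately have "s * (t + s) \<le> 2 * t * t * (t - s) * (t + s)"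
      by (simp add: mult.assoc)
    hence "s \<le> 2 * t * t * (t - s)" using st by simp
    hence "1 / (t * t * t) \<le> 2 / s - 2 / t" using st by (simp add: field_simps)
    thus ?thesis by (simp add: sq(1) flip: s_def t_def)
  qed
  have "(\<Sum>m=2..Suc k. 1 / (real m * sqrt (real m))) \<le> 2 - 2 / sqrt (real (Suc k))" for k
  proof (induction k)
    case (Suc k)
    thus ?case using step[of "real (Suc k)"] by (simp add: add.commute)
  qed simp
  moreover have "2 - 2 / sqrt (real (Suc k)) \<le> 2" for k by simp
  ultimately have "(\<Sum>m=2..Suc k. 1 / (real m * sqrt (real m))) \<le> 2" for k
    using order_trans by blast
  thus ?thesis by (cases n) auto
qed

lemma sum_le_sum_inj_on:
  fixes f :: "'a \<Rightarrow> real"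
  assumes "finite T" "inj_on h S" "h ` S \<subseteq> T"
    and "\<And>x. x \<in> S \<Longrightarrow> f x \<le> g (h x)" "\<And>y. y \<in> T \<Longrightarrow> 0 \<le> g y"
  shows "sum f S \<le> sum g T"
proof -
  have "sum f S \<le> sum (g \<circ> h) S" using assms(4) by (auto intro: sum_mono)
  also have "\<dots> = sum g (h ` S)" using assms(2) by (simp add: sum.reindex)
  also have "\<dots> \<le> sum g T" using assms by (intro sum_mono2) auto
  finally show ?thesis .
qed

section \<open>Consequences of 2-primitivity\<close>

lemma k_primitive_2D:
  assumes "k_primitive 2 A" "a \<in> A"
  shows k_primitive_2_gt_1: "1 < a"
    and k_primitive_2_not_dvd: "b \<in> A \<Longrightarrow> b \<noteq> a \<Longrightarrow> \<not> a dvd b"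
    and k_primitive_2_not_dvd_mult:
      "b \<in> A \<Longrightarrow> c \<in> A \<Longrightarrow> b \<noteq> a \<Longrightarrow> c \<noteq> a \<Longrightarrow> b \<noteq> c \<Longrightarrow> \<not> a dvd b * c"
    and k_primitive_2_third: "\<exists>c\<in>A. c \<noteq> a \<and> c \<noteq> b"
proof -
  show "1 < a" using assms by (auto simp: k_primitive_def)
  have *: "\<not> a dvd b * c" if "b \<in> A" "c \<in> A" "b \<noteq> a" "c \<noteq> a" "b \<noteq> c" for b c
  proof -
    have pair: "{b, c} \<subseteq> A - {a} \<and> finite {b, c} \<and> card {b, c} = 2" using that by auto
    have "\<not> a dvd \<Prod>{b, c}"
      using assms pair unfolding k_primitive_def by blast
    thus ?thesis using that by simp
  qed
  show "b \<in> A \<Longrightarrow> c \<in> A \<Longrightarrow> b \<noteq> a \<Longrightarrow> c \<noteq> a \<Longrightarrow> b \<noteq> c \<Longrightarrow> \<not> a dvd b * c"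
    by (rule *)
  have third: "\<exists>c\<in>A. c \<noteq> a \<and> c \<noteq> b" for b
  proof (rule ccontr)
    assume "\<not> ?thesis"
    hence "A \<subseteq> {a, b}" by auto
    moreover from this have "card A \<le> card {a, b}" by (intro card_mono) auto
    moreover have "card {a, b} \<le> 2" by (simp add: card_insert_if)
    ultimately show False
      using assms(1) finite_subset[of A "{a, b}"] by (auto simp: k_primitive_def)
  qed
  thus "\<exists>c\<in>A. c \<noteq> a \<and> c \<noteq> b" .
  show "\<not> a dvd b" if b: "b \<in> A" "b \<noteq> a"
  proof
    assume "a dvd b"
    \<comment> \<open>The hypothesis only speaks of exactly two other elements, so \<open>b\<close>
      is padded with a third element \<open>c\<close>.\<close>
    obtain c where "c \<in> A" "c \<noteq> a" "c \<noteq> b" using third by blast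
    with *[of b c] b \<open>a dvd b\<close> show False by auto
  qed
qed

text \<open>
  Without coprimality this fails: \<open>u\<close> and \<open>v\<close> may divide the same single further element
  \<open>b\<close>, and then only \<open>a dvd b\<^sup>2\<close> follows.
\<close>
lemma coprime_factors_private:
  assumes "k_primitive 2 A" "a \<in> A" "a = u * v" "coprime u v"
  shows "private_divisor A a u \<or> private_divisor A a v"
proof (rule ccontr)
  assume "\<not> ?thesis"
  then obtain b c where bc: "b \<in> A" "u dvd b" "b \<noteq> a" "c \<in> A" "v dvd c" "c \<noteq> a"
    using assms(3) by (auto simp: private_divisor_def)
  show False
  proof (cases "b = c")
    case True
    hence "a dvd b" using bc assms by (simp add: divides_mult)
    thus False using k_primitive_2_not_dvd[OF assms(1,2)] bc by blast
  next
    case False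
    thus False using k_primitive_2_not_dvd_mult[OF assms(1,2)] bc assms(3) mult_dvd_mono by blast
  qed
qed

section \<open>Unitary factors and small private divisors\<close>

lemma unitary_prime_power_split:
  assumes "0 < (u :: nat)" "prime p" "p dvd u"
  obtains k w where "u = p ^ k * w" "0 < k" "\<not> p dvd w"
proof -
  have "u \<noteq> 0" "\<not> is_unit p" using assms by auto
  then obtain w where "u = p ^ multiplicity p u * w" "\<not> p dvd w"
    using multiplicity_decompose'[of u p] by metis
  moreover have "0 < multiplicity p u"
    using assms by (simp add: prime_multiplicity_gt_zero_iff)
  ultimately show ?thesis using that by blast
qed

text \<open>Take the least unitary divisor \<open>u\<close> of \<open>a\<close> with
  \<open>a \<le> u ^ 3\<close> and split off a full prime power, \<open>u = p ^ k * w\<close>. If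
  \<open>p ^ k\<close> alone has cube at least \<open>a\<close>, its cofactor is private and small.
  Otherwise \<open>p ^ k\<close> and, by minimality, \<open>w\<close> have cubes below
  \<open>a\<close>, so both \<open>u\<close> and its cofactor \<open>v\<close> are small, and one of
  them is private.\<close>

lemma small_private_divisor:
  assumes A: "k_primitive 2 A" "a \<in> A"
    and no_pp: "\<And>p k. prime p \<Longrightarrow> \<not> private_divisor A a (p ^ k)"
  obtains d where "private_divisor A a d" "d ^ 3 \<le> a ^ 2"
proof -
  have a: "1 < a" using A by (rule k_primitive_2_gt_1)
  define U where "U u \<longleftrightarrow> (\<exists>v. a = u * v \<and> coprime u v) \<and> a \<le> u ^ 3" for u
  have "U a" using a by (auto simp: U_def intro: self_le_power)
  define u where "u = (LEAST u. U u)"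
  have "U u" unfolding u_def using \<open>U a\<close> by (rule LeastI)
  then obtain v where v: "a = u * v" "coprime u v" and ua: "a \<le> u ^ 3" by (auto simp: U_def)
  have pos: "0 < u" "0 < v" using v a by (auto intro: Nat.gr0I)
  have complement_le: "y ^ 3 \<le> a ^ 2" if "a = x * y" "a \<le> x ^ 3" for x y
  proof -
    have "a * y ^ 3 \<le> x ^ 3 * y ^ 3" using that by simp
    also have "\<dots> = a * a ^ 2" by (simp add: that(1) power_mult_distrib power3_eq_cube power2_eq_square)
    finally show ?thesis using a by simp
  qed
  have "u \<noteq> 1" using ua a by auto
  then obtain p where p: "prime p" "p dvd u" using prime_factor_nat by blast
  then obtain k w where kw: "u = p ^ k * w" "0 < k" "\<not> p dvd w"
    using unitary_prime_power_split pos by metis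
  have cop: "coprime (p ^ k) w" using p kw by (simp add: prime_imp_coprime)
  have copv: "coprime (p ^ k) v" "coprime w v" using v kw by auto
  have split: "a = p ^ k * (w * v)" using v kw by simp
  show ?thesis
  proof (cases "a \<le> (p ^ k) ^ 3")
    case True
    have "private_divisor A a (w * v)"
      using coprime_factors_private[OF A split] no_pp[OF p(1)] cop copv by auto
    thus ?thesis using that complement_le[OF split True] by blast
  next
    case False
    have "1 < p ^ k" using one_less_power[OF prime_gt_1_nat[OF p(1)] kw(2)] .
    moreover have "0 < w" using pos kw by (intro Nat.gr0I) auto
    ultimately have "w < u" by (simp add: kw(1))
    hence "\<not> U w" unfolding u_def by (rule not_less_Least)
    moreover have "a = w * (p ^ k * v)" "coprime w (p ^ k * v)"
      using split cop copv by (auto simp: ac_simps)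
    ultimately have "w ^ 3 < a" unfolding U_def using not_le by blast
    hence "u ^ 3 \<le> a ^ 2"
      using False by (simp add: kw(1) power_mult_distrib power2_eq_square mult_mono)
    thus ?thesis
      using coprime_factors_private[OF A v] complement_le[OF v(1) ua] that by blast
  qed
qed

text \<open>An odd \<open>p\<close> is wanted because the constants used later do not fit
  \<open>p = 2\<close>: there \<open>2 / (3/2 * sqrt 2) + 1/4\<close> exceeds 1.\<close>

lemma odd_prime_cofactor:
  assumes "\<And>p k. prime p \<Longrightarrow> d \<noteq> p ^ k" "0 < (d :: nat)"
  obtains p m where "prime p" "3 \<le> p" "2 \<le> m" "d = p * m"
proof -
  have "\<exists>p. prime p \<and> p dvd d \<and> p \<noteq> 2"
  proof (rule ccontr)
    assume *: "\<not> ?thesis"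
    \<comment> \<open>The exponent 0 is allowed in the hypothesis, so it excludes
      \<open>d = 1\<close> as well.\<close>
    have "d \<noteq> 1" using assms(1)[of 2 0] by auto
    then obtain q where "prime q" "q dvd d" using prime_factor_nat by blast
    with * have "2 dvd d" by auto
    then obtain k w where kw: "d = 2 ^ k * w" "\<not> 2 dvd w"
      using unitary_prime_power_split[OF assms(2) two_is_prime_nat] by metis
    have "w \<noteq> 1" using kw assms(1)[of 2 k] by auto
    then obtain r where "prime r" "r dvd w" using prime_factor_nat by blast
    moreover from this * kw have "r = 2" using dvd_mult by blast
    ultimately show False using kw by simp
  qed
  then obtain p m where p: "prime p" "p \<noteq> 2" "d = p * m" by auto
  moreover have "3 \<le> p" using p prime_ge_2_nat[of p] by linarith
  moreover have "m \<noteq> 0" "m \<noteq> 1" using p assms(2) assms(1)[of p 1] by auto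
  ultimately show ?thesis using that[of p m] by linarith
qed

text \<open>
  The constant comes from \<open>1 / (3/2 \<cdot> p\<^bsup>1/2\<^esup>) \<le> 5/12\<close>, using \<open>3\<^bsup>1/2\<^esup> \<ge> 8/5\<close>; it is chosen so that
  \<open>2 \<cdot> 5/12 + 1/6 = 1\<close>, where \<open>1 / (2 p) \<le> 1/6\<close> is the share of the private prime powers.
\<close>
lemma erdos_weight_le_of_divisor:
  assumes "3 \<le> p" "2 \<le> m" "(p * m) ^ 3 \<le> a ^ 2"
  shows "erdos_weight a \<le> 5 / 12 * erdos_weight p * (1 / (real m * sqrt (real m)))"
proof -
  have pos: "1 < p * m" using mult_le_mono[OF assms(1,2)] by simp
  have "real ((p * m) ^ 3) \<le> real (a ^ 2)" using assms(3) of_nat_le_iff by blast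
  hence cube: "real (p * m) ^ 3 \<le> real a ^ 2" by simp
  have a: "0 < a" using assms(3) pos by (intro Nat.gr0I) auto
  have "(8 / 5 :: real) \<le> sqrt (real p)"
    using assms(1) by (intro real_le_rsqrt) (simp add: power2_eq_square)
  hence "8 / 5 * (real p * (real m * sqrt (real m))) \<le> sqrt (real p) * (real p * (real m * sqrt (real m)))"
    by (intro mult_right_mono) auto
  also have "\<dots> = sqrt (real (p * m) ^ 3)"
    by (simp add: real_sqrt_mult power3_eq_cube mult_ac)
  also have "\<dots> \<le> real a" using cube real_sqrt_le_mono by fastforce
  finally have le: "8 / 5 * (real p * (real m * sqrt (real m))) \<le> real a" .
  have "ln (real (p * m) ^ 3) \<le> ln (real a ^ 2)" 
    using cube assms a by (intro ln_mono zero_less_power) auto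
  hence "3 * ln (real (p * m)) \<le> 2 * ln (real a)" using pos a by (simp add: ln_realpow del: of_nat_mult)
  moreover have "ln (real p) \<le> ln (real (p * m))" using assms by (intro ln_mono) auto
  ultimately have ln: "3 / 2 * ln (real p) \<le> ln (real a)" by simp
  have lnp: "0 < ln (real p)" using assms by simp
  with ln have lna: "0 < ln (real a)" by linarith
  have "8 / 5 * (real p * (real m * sqrt (real m))) * (3 / 2 * ln (real p)) \<le> real a * ln (real a)"
    using le ln lnp by (intro mult_mono) auto
  hence "erdos_weight a \<le> 1 / (8 / 5 * (real p * (real m * sqrt (real m))) * (3 / 2 * ln (real p)))"
    unfolding erdos_weight_def using assms a lnp lna by (intro divide_left_mono) (auto intro!: mult_pos_pos)
  also have "\<dots> = 5 / 12 * erdos_weight p * (1 / (real m * sqrt (real m)))"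
    by (simp add: erdos_weight_def)
  finally show ?thesis .
qed

section \<open>Charging the elements to primes\<close>

text \<open>Privacy is taken relative to all of \<open>A\<close>, since a finite part
  \<open>F\<close> may be too small to be 2-primitive itself.\<close>

lemma finite_sum_erdos_weight_le:
  assumes A: "k_primitive 2 A" and F: "finite F" "F \<subseteq> A"
  shows "sum erdos_weight F \<le> sum erdos_weight (primes_dividing F)"
proof -
  define G where "G = primes_dividing F"
  have gt1: "1 < a" if "a \<in> F" for a using k_primitive_2_gt_1[OF A] that F by blast
  have "G \<subseteq> (\<Union>a\<in>F. {p. p dvd a})" by (auto simp: G_def primes_dividing_def)
  moreover have "finite {p. p dvd a}" if "a \<in> F" for a using gt1[OF that] by simp
  ultimately have "finite G" using F(1) by (meson finite_UN finite_subset)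
  define G1 where "G1 = {p\<in>G. \<exists>a\<in>A. private_divisor A a p}"
  define G2 where "G2 = G - G1"
  have G12: "G = G1 \<union> G2" "G1 \<inter> G2 = {}" "finite G1" "finite G2"
    using \<open>finite G\<close> by (auto simp: G1_def G2_def)
  define F1 where "F1 = {a\<in>F. \<exists>p. prime p \<and> private_divisor A a p}"
  define F2 where "F2 = {a\<in>F - F1. \<exists>p k. prime p \<and> private_divisor A a (p ^ k)}"
  define F3 where "F3 = F - F1 - F2"
  \<comment> \<open>A prime dividing \<open>a\<close> that is private for some \<open>b\<close>
    forces \<open>a = b\<close>, which would put \<open>a\<close> into \<open>F1\<close>.\<close>
  have non_private: "p \<in> G2" if "a \<in> F - F1" "prime p" "p dvd a" for a p
  proof -
    have "p \<in> G" using that by (auto simp: G_def primes_dividing_def)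
    moreover have "\<not> private_divisor A b p" if "b \<in> A" for b
    proof
      assume "private_divisor A b p"
      moreover from this have "a = b"
        using \<open>a \<in> F - F1\<close> \<open>p dvd a\<close> F by (auto simp: private_divisor_def)
      ultimately show False using \<open>a \<in> F - F1\<close> \<open>prime p\<close> by (auto simp: F1_def)
    qed
    ultimately show ?thesis by (auto simp: G1_def G2_def)
  qed

  \<comment> \<open>First class: private primes\<close>
  have "\<forall>a\<in>F1. \<exists>p. prime p \<and> private_divisor A a p" by (auto simp: F1_def)
  then obtain h1 where h1: "\<And>a. a \<in> F1 \<Longrightarrow> prime (h1 a) \<and> private_divisor A a (h1 a)" by metis
  have sum1: "sum erdos_weight F1 \<le> sum erdos_weight G1"
  proof (rule sum_le_sum_inj_on[where h = h1])
    show "inj_on h1 F1"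
      using h1 F by (intro inj_onI) (metis (no_types, lifting) F1_def mem_Collect_eq private_divisor_def subsetD)
    show "h1 ` F1 \<subseteq> G1"
    proof safe
      fix a assume a: "a \<in> F1"
      hence "a \<in> F" "a \<in> A" using F by (auto simp: F1_def)
      moreover have "h1 a dvd a" using h1[OF a] by (simp add: private_divisor_def)
      ultimately show "h1 a \<in> G1" using h1[OF a] by (auto simp: G1_def G_def primes_dividing_def)
    qed
    show "erdos_weight a \<le> erdos_weight (h1 a)" if "a \<in> F1" for a
      using h1[OF that] gt1[of a] that
      by (intro erdos_weight_antimono) (auto simp: F1_def private_divisor_def prime_gt_Suc_0_nat dvd_imp_le)
  qed (use G12 erdos_weight_nonneg in auto)

  \<comment> \<open>Second class: private prime powers\<close>
  have "\<forall>a\<in>F2. \<exists>p k. prime p \<and> private_divisor A a (p ^ k)" by (auto simp: F2_def)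
  then obtain h2 k where h2: "\<And>a. a \<in> F2 \<Longrightarrow> prime (h2 a) \<and> private_divisor A a (h2 a ^ k a)"
    by metis
  have k_ge_2: "2 \<le> k a" if "a \<in> F2" for a
  proof -
    have a: "a \<in> A" "a \<in> F" "a \<notin> F1" using that F by (auto simp: F2_def)
    obtain c where "c \<in> A" "c \<noteq> a" using k_primitive_2_third[OF A a(1)] by blast
    \<comment> \<open>Exponent 0 would make 1 private, yet 1 also divides \<open>c\<close>.\<close>
    hence "k a \<noteq> 0" using h2[OF that] by (metis one_dvd power_0 private_divisor_def)
    moreover have "k a \<noteq> 1" using h2[OF that] a by (auto simp: F1_def)
    ultimately show ?thesis by linarith
  qed
  have h2_dvd: "(h2 a)\<^sup>2 dvd a" if "a \<in> F2" for a
    using h2[OF that] k_ge_2[OF that] by (meson dvd_trans le_imp_power_dvd private_divisor_def)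
  \<comment> \<open>The third class never charges 2, so 2 may be spent in full here; an odd
    \<open>p\<close> gives up \<open>1 / (2 * p) \<le> 1/6\<close> and keeps 5/6 for the third
    class.\<close>
  have sum2: "sum erdos_weight F2 \<le> (\<Sum>p\<in>G2. if p = 2 then erdos_weight p else erdos_weight p / 6)"
  proof (rule sum_le_sum_inj_on[where h = h2])
    \<comment> \<open>For a common prime, the private power with the smaller exponent divides the
      other element too.\<close>
    have eq: "a = b" if "a \<in> F2" "b \<in> F2" "h2 a = h2 b" "k a \<le> k b" for a b
    proof -
      have "h2 a ^ k a dvd b"
        using that h2[of b] by (metis dvd_trans le_imp_power_dvd private_divisor_def)
      thus ?thesis using h2[of a] that F by (auto simp: private_divisor_def F2_def)
    qed
    show "inj_on h2 F2" using eq by (intro inj_onI) (metis nle_le)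
    show "h2 ` F2 \<subseteq> G2"
    proof safe
      fix a assume "a \<in> F2"
      thus "h2 a \<in> G2" using h2[of a] h2_dvd[of a]
        by (intro non_private[of a]) (auto simp: F2_def power2_eq_square dest: dvd_mult_left)
    qed
    show "erdos_weight a \<le> (if h2 a = 2 then erdos_weight (h2 a) else erdos_weight (h2 a) / 6)"
      if "a \<in> F2" for a
    proof -
      define p where "p = h2 a"
      have p: "1 < p" using h2[OF that] by (simp add: p_def prime_gt_Suc_0_nat)
      have "p\<^sup>2 \<le> a" using h2_dvd[OF that] gt1[of a] that by (auto simp: p_def F2_def dvd_imp_le)
      hence "erdos_weight a \<le> erdos_weight (p\<^sup>2)"
        using p by (intro erdos_weight_antimono one_less_power) auto
      hence le: "erdos_weight a \<le> erdos_weight p / (2 * real p)" using p by (simp add: erdos_weight_square)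
      have "erdos_weight p / (2 * real p) \<le> erdos_weight p / (if p = 2 then 1 else 6)"
        using p by (intro divide_left_mono erdos_weight_nonneg) auto
      with le show ?thesis by (auto simp: p_def)
    qed
  qed (use G12 erdos_weight_nonneg in auto)

  \<comment> \<open>Third class: small private divisors with an odd prime factor\<close>
  have "\<forall>a\<in>F3. \<exists>p m. prime p \<and> 3 \<le> p \<and> 2 \<le> m \<and> private_divisor A a (p * m) \<and> (p * m) ^ 3 \<le> a ^ 2"
  proof
    fix a assume "a \<in> F3"
    hence a: "a \<in> A" "\<And>p k. prime p \<Longrightarrow> \<not> private_divisor A a (p ^ k)"
      using F by (auto simp: F3_def F2_def)
    obtain d where d: "private_divisor A a d" "d ^ 3 \<le> a ^ 2"
      using small_private_divisor[OF A a] by blast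
    moreover have "d \<noteq> p ^ k" if "prime p" for p k using a(2) d(1) that by blast
    moreover have "0 < d" using d gt1[of a] \<open>a \<in> F3\<close> by (auto simp: private_divisor_def F3_def intro: Nat.gr0I)
    ultimately show "\<exists>p m. prime p \<and> 3 \<le> p \<and> 2 \<le> m \<and> private_divisor A a (p * m) \<and> (p * m) ^ 3 \<le> a ^ 2"
      using odd_prime_cofactor[of d] by metis
  qed
  then obtain q m where qm: "\<And>a. a \<in> F3 \<Longrightarrow> prime (q a) \<and> 3 \<le> q a \<and> 2 \<le> m a \<and>
      private_divisor A a (q a * m a) \<and> (q a * m a) ^ 3 \<le> a ^ 2"
    by metis
  \<comment> \<open>A common bound on the cofactors makes the target \<open>T\<close> finite; the
    inserted 0 covers empty \<open>F3\<close>.\<close>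
  define N where "N = Max (insert 0 (m ` F3))"
  have "finite F3" using F by (simp add: F3_def)
  hence m_le: "m a \<le> N" if "a \<in> F3" for a using that by (auto simp: N_def)
  define T where "T = (G2 - {2}) \<times> {2..N}"
  have "sum erdos_weight F3 \<le>
      (\<Sum>(p, m)\<in>T. 5 / 12 * erdos_weight p * (1 / (real m * sqrt (real m))))"
  proof (rule sum_le_sum_inj_on[where h = "\<lambda>a. (q a, m a)"])
    show "inj_on (\<lambda>a. (q a, m a)) F3"
    proof (rule inj_onI)
      fix a b assume ab: "a \<in> F3" "b \<in> F3" "(q a, m a) = (q b, m b)"
      hence "q a * m a dvd b" using qm[of b] by (simp add: private_divisor_def)
      thus "a = b" using qm[of a] ab F by (auto simp: private_divisor_def F3_def)
    qed
    show "(\<lambda>a. (q a, m a)) ` F3 \<subseteq> T"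
    proof safe
      fix a assume a: "a \<in> F3"
      hence "q a \<in> G2" using qm[OF a]
        by (intro non_private[of a]) (auto simp: F3_def private_divisor_def dest: dvd_mult_left)
      thus "(q a, m a) \<in> T" using qm[OF a] m_le[OF a] by (auto simp: T_def)
    qed
  qed (use G12 erdos_weight_nonneg erdos_weight_le_of_divisor qm in \<open>auto simp: T_def\<close>)
  also have "\<dots> = (\<Sum>p\<in>G2 - {2}. 5 / 12 * erdos_weight p * (\<Sum>m=2..N. 1 / (real m * sqrt (real m))))"
    unfolding T_def by (simp only: sum.cartesian_product[symmetric] sum_distrib_left)
  also have "\<dots> \<le> (\<Sum>p\<in>G2 - {2}. 5 / 12 * erdos_weight p * 2)"
    by (intro sum_mono mult_left_mono sum_inverse_three_halves_le) (simp add: erdos_weight_nonneg)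
  also have "\<dots> = (\<Sum>p\<in>G2. if p = 2 then 0 else 5 / 6 * erdos_weight p)"
    using G12 by (intro sum.mono_neutral_cong_left) auto
  finally have sum3: "sum erdos_weight F3 \<le> \<dots>" .

  have "F = F1 \<union> F2 \<union> F3" "F1 \<inter> F2 = {}" "(F1 \<union> F2) \<inter> F3 = {}" "finite F1" "finite F2" "finite F3"
    using F by (auto simp: F1_def F2_def F3_def)
  hence "sum erdos_weight F = sum erdos_weight F1 + (sum erdos_weight F2 + sum erdos_weight F3)"
    by (simp add: sum.union_disjoint)
  also have "\<dots> \<le> sum erdos_weight G1 +
      ((\<Sum>p\<in>G2. if p = 2 then erdos_weight p else erdos_weight p / 6) +
       (\<Sum>p\<in>G2. if p = 2 then 0 else 5 / 6 * erdos_weight p))"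
    using sum1 sum2 sum3 by linarith
  also have "\<dots> = sum erdos_weight G1 + sum erdos_weight G2"
    unfolding sum.distrib[symmetric] by (intro arg_cong2[where f = "(+)"] sum.cong refl) auto
  also have "\<dots> = sum erdos_weight G" using G12 by (simp add: sum.union_disjoint)
  finally show ?thesis by (simp add: G_def)
qed

theorem theorem1p2:
  fixes A :: "nat set"
  assumes "k_primitive 2 A"
  shows "(\<Sum>\<^sub>\<infinity>n\<in>A. ennreal (1 / (real n * ln (real n))))
       \<le> (\<Sum>\<^sub>\<infinity>p\<in>primes_dividing A. ennreal (1 / (real p * ln (real p))))"
proof -
  \<comment> \<open>In \<open>ennreal\<close> the infinite sum is the supremum of its finite partial
    sums, so it suffices to bound each finite \<open>F\<close>.\<close>
  have "(\<Sum>\<^sub>\<infinity>n\<in>A. ennreal (erdos_weight n)) \<le> (\<Sum>\<^sub>\<infinity>p\<in>primes_dividing A. ennreal (erdos_weight p))"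
  proof (subst nonneg_infsum_complete, simp, rule SUP_least)
    fix F assume "F \<in> {F. finite F \<and> F \<subseteq> A}"
    hence F: "finite F" "F \<subseteq> A" by auto
    have "(\<Sum>n\<in>F. ennreal (erdos_weight n)) = ennreal (sum erdos_weight F)"
      by (simp add: erdos_weight_nonneg)
    also have "\<dots> \<le> ennreal (sum erdos_weight (primes_dividing F))"
      by (intro ennreal_leI finite_sum_erdos_weight_le[OF assms F])
    also have "\<dots> = (\<Sum>p\<in>primes_dividing F. ennreal (erdos_weight p))"
      by (simp add: erdos_weight_nonneg)
    also have "\<dots> \<le> (\<Sum>\<^sub>\<infinity>p\<in>primes_dividing A. ennreal (erdos_weight p))"
    \<comment> \<open>In the infinite case \<open>sum\<close> takes its default value 0.\<close>
    proof (cases "finite (primes_dividing F)")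
      case True
      moreover have "primes_dividing F \<subseteq> primes_dividing A"
        using F by (auto simp: primes_dividing_def)
      ultimately show ?thesis
        by (subst nonneg_infsum_complete) (auto intro: SUP_upper)
    qed simp
    finally show "(\<Sum>n\<in>F. ennreal (erdos_weight n)) \<le>
        (\<Sum>\<^sub>\<infinity>p\<in>primes_dividing A. ennreal (erdos_weight p))" .
  qed
  thus ?thesis by (simp only: erdos_weight_def)
qed

end
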